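(* The maximum weight clique problem can be solved in $O(n^3)$ time for $(P_7,C_4,C_5)$-free graphs, where $n$ denotes the number of vertices of the input graph.
   Context: All graphs are finite, simple and nonnull. $P_k$ is the path on $k$ vertices and $C_k$ the cycle on $k$ vertices. A graph is $\mathcal{H}$-free if no induced subgraph of it is isomorphic to a member of $\mathcal{H}$. A clique is a (possibly empty) set of pairwise adjacent vertices. The maximum weight clique problem: given a graph $G$ and a weight function $w:V(G)\to\mathbb{R}$, find a clique $K$ of $G$ for which $w(K)=\sum_{v\in K}w(v)$ is maximum. *)

theory Defs
  imports Complex_Main "HOL-Library.Landau_Symbols"
begin

section \<open>Graphs\<close>

record 'a graph =
  verts :: "'a set"
  adj :: "'a \<Rightarrow> 'a \<Rightarrow> bool"

definition simple_graph :: "'a graph \<Rightarrow> bool" where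
  "simple_graph G \<longleftrightarrow>
     finite (verts G) \<and> verts G \<noteq> {} \<and>
     (\<forall>u v. adj G u v \<longrightarrow> u \<in> verts G \<and> v \<in> verts G) \<and>
     (\<forall>u v. adj G u v \<longrightarrow> adj G v u) \<and>
     (\<forall>v. \<not> adj G v v)"

definition induced_subgraph :: "'a graph \<Rightarrow> 'a set \<Rightarrow> 'a graph" where
  "induced_subgraph G S =
     \<lparr>verts = S, adj = (\<lambda>u v. u \<in> S \<and> v \<in> S \<and> adj G u v)\<rparr>"

definition graph_isomorphic :: "'a graph \<Rightarrow> 'b graph \<Rightarrow> bool" where
  "graph_isomorphic G H \<longleftrightarrow>
     (\<exists>f. bij_betw f (verts G) (verts H) \<and>
          (\<forall>u \<in> verts G. \<forall>v \<in> verts G. adj G u v \<longleftrightarrow> adj H (f u) (f v)))"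

definition graph_free :: "'b graph set \<Rightarrow> 'a graph \<Rightarrow> bool" where
  "graph_free \<H> G \<longleftrightarrow>
     (\<forall>H \<in> \<H>. \<not> (\<exists>S \<subseteq> verts G. graph_isomorphic (induced_subgraph G S) H))"

definition path_graph :: "nat \<Rightarrow> nat graph" where
  "path_graph k =
     \<lparr>verts = {..<k}, adj = (\<lambda>i j. i < k \<and> j < k \<and> (j = Suc i \<or> i = Suc j))\<rparr>"

text \<open>Meaningful for \<open>k \<ge> 3\<close> only.\<close>

definition cycle_graph :: "nat \<Rightarrow> nat graph" where
  "cycle_graph k =
     \<lparr>verts = {..<k},
      adj = (\<lambda>i j. i < k \<and> j < k \<and> (j = Suc i mod k \<or> i = Suc j mod k))\<rparr>"

lemma simple_path_graph: "k \<ge> 1 \<Longrightarrow> simple_graph (path_graph k)"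
  by (auto simp: simple_graph_def path_graph_def lessThan_empty_iff)

lemma simple_cycle_graph: "k \<ge> 3 \<Longrightarrow> simple_graph (cycle_graph k)"
proof -
  assume k: "k \<ge> 3"
  have "i \<noteq> Suc i mod k" if "i < k" for i
    using that k by (cases "Suc i = k") auto
  then show ?thesis
    using k by (auto simp: simple_graph_def cycle_graph_def lessThan_empty_iff)
qed

definition clique :: "'a graph \<Rightarrow> 'a set \<Rightarrow> bool" where
  "clique G K \<longleftrightarrow> K \<subseteq> verts G \<and> (\<forall>u \<in> K. \<forall>v \<in> K. u \<noteq> v \<longrightarrow> adj G u v)"

definition max_weight_clique :: "'a graph \<Rightarrow> ('a \<Rightarrow> real) \<Rightarrow> 'a set \<Rightarrow> bool" where
  "max_weight_clique G w K \<longleftrightarrow> is_arg_max (\<lambda>K. \<Sum>v\<in>K. w v) (clique G) K"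


section \<open>Random access machine\<close>

text \<open>
  The model of computation is a unit-cost random access machine, programmed in a while-language.
  A program uses finitely many named arrays, each of which has two indices and holds either
  natural numbers or reals; scalars are the entries with index \<open>(0, 0)\<close>.

  The only arithmetic on natural numbers is successor and predecessor. Hence, in time \<open>t\<close>, a
  fixed program on an input with entries at most \<open>n\<close> only ever produces numbers in \<open>O(n + t)\<close>.
  For polynomial \<open>t\<close> these fit into \<open>O(log n)\<close> bits, so an index pair is a constant number of
  machine words, and unit cost cannot be exploited by computing with huge numbers.
  Reals (the weights) can only be added, subtracted and compared; in particular they cannot be
  rounded to natural numbers.
\<close>

record store =
  nat_cell :: "string \<Rightarrow> nat \<Rightarrow> nat \<Rightarrow> nat"
  real_cell :: "string \<Rightarrow> nat \<Rightarrow> nat \<Rightarrow> real"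

datatype nexp =
    NConst nat
  | NCell string nexp nexp
  | NSucc nexp
  | NPred nexp

datatype rexp =
    RZero
  | RCell string nexp nexp
  | RAdd rexp rexp
  | RSub rexp rexp

datatype bexp =
    NEq nexp nexp
  | NLess nexp nexp
  | RLess rexp rexp
  | BNot bexp
  | BAnd bexp bexp

datatype com =
    Skip
  | NAssign string nexp nexp nexp
  | RAssign string nexp nexp rexp
  | Seq com com
  | Cond bexp com com
  | While bexp com

primrec nval :: "nexp \<Rightarrow> store \<Rightarrow> nat" where
  "nval (NConst k) s = k"
| "nval (NCell a i j) s = nat_cell s a (nval i s) (nval j s)"
| "nval (NSucc e) s = nval e s + 1"
| "nval (NPred e) s = nval e s - 1"

primrec rval :: "rexp \<Rightarrow> store \<Rightarrow> real" where
  "rval RZero s = 0"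
| "rval (RCell a i j) s = real_cell s a (nval i s) (nval j s)"
| "rval (RAdd e f) s = rval e s + rval f s"
| "rval (RSub e f) s = rval e s - rval f s"

primrec bval :: "bexp \<Rightarrow> store \<Rightarrow> bool" where
  "bval (NEq e f) s \<longleftrightarrow> nval e s = nval f s"
| "bval (NLess e f) s \<longleftrightarrow> nval e s < nval f s"
| "bval (RLess e f) s \<longleftrightarrow> rval e s < rval f s"
| "bval (BNot b) s \<longleftrightarrow> \<not> bval b s"
| "bval (BAnd b c) s \<longleftrightarrow> bval b s \<and> bval c s"

text \<open>Every operation and memory access in an expression costs one time unit.\<close>

primrec ncost :: "nexp \<Rightarrow> nat" where
  "ncost (NConst k) = 1"
| "ncost (NCell a i j) = 1 + ncost i + ncost j"
| "ncost (NSucc e) = 1 + ncost e"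
| "ncost (NPred e) = 1 + ncost e"

primrec rcost :: "rexp \<Rightarrow> nat" where
  "rcost RZero = 1"
| "rcost (RCell a i j) = 1 + ncost i + ncost j"
| "rcost (RAdd e f) = 1 + rcost e + rcost f"
| "rcost (RSub e f) = 1 + rcost e + rcost f"

primrec bcost :: "bexp \<Rightarrow> nat" where
  "bcost (NEq e f) = 1 + ncost e + ncost f"
| "bcost (NLess e f) = 1 + ncost e + ncost f"
| "bcost (RLess e f) = 1 + rcost e + rcost f"
| "bcost (BNot b) = 1 + bcost b"
| "bcost (BAnd b c) = 1 + bcost b + bcost c"

definition nat_write :: "string \<Rightarrow> nat \<Rightarrow> nat \<Rightarrow> nat \<Rightarrow> store \<Rightarrow> store" where
  "nat_write a i j x s =
     s\<lparr>nat_cell := (\<lambda>a' i' j'. if a' = a \<and> i' = i \<and> j' = j then x else nat_cell s a' i' j')\<rparr>"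

definition real_write :: "string \<Rightarrow> nat \<Rightarrow> nat \<Rightarrow> real \<Rightarrow> store \<Rightarrow> store" where
  "real_write a i j x s =
     s\<lparr>real_cell := (\<lambda>a' i' j'. if a' = a \<and> i' = i \<and> j' = j then x else real_cell s a' i' j')\<rparr>"

text \<open>\<open>exec c s t s'\<close>: started in \<open>s\<close>, the command \<open>c\<close> halts after \<open>t\<close> time units in \<open>s'\<close>.\<close>

inductive exec :: "com \<Rightarrow> store \<Rightarrow> nat \<Rightarrow> store \<Rightarrow> bool" where
  exec_Skip: "exec Skip s 1 s"
| exec_NAssign: "exec (NAssign a i j e) s (1 + ncost i + ncost j + ncost e)
     (nat_write a (nval i s) (nval j s) (nval e s) s)"
| exec_RAssign: "exec (RAssign a i j e) s (1 + ncost i + ncost j + rcost e)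
     (real_write a (nval i s) (nval j s) (rval e s) s)"
| exec_Seq: "exec c s t s' \<Longrightarrow> exec d s' u s'' \<Longrightarrow> exec (Seq c d) s (t + u) s''"
| exec_CondTrue: "bval b s \<Longrightarrow> exec c s t s' \<Longrightarrow> exec (Cond b c d) s (1 + bcost b + t) s'"
| exec_CondFalse: "\<not> bval b s \<Longrightarrow> exec d s t s' \<Longrightarrow> exec (Cond b c d) s (1 + bcost b + t) s'"
| exec_WhileFalse: "\<not> bval b s \<Longrightarrow> exec (While b c) s (1 + bcost b) s"
| exec_WhileTrue: "bval b s \<Longrightarrow> exec c s t s' \<Longrightarrow> exec (While b c) s' u s'' \<Longrightarrow>
     exec (While b c) s (1 + bcost b + t + u) s''"

inductive_cases exec_SkipE: "exec Skip s t s'"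
inductive_cases exec_NAssignE: "exec (NAssign a i j e) s t s'"
inductive_cases exec_RAssignE: "exec (RAssign a i j e) s t s'"
inductive_cases exec_SeqE: "exec (Seq c d) s t s'"
inductive_cases exec_CondE: "exec (Cond b c d) s t s'"
inductive_cases exec_WhileE: "exec (While b c) s t s'"

lemma exec_deterministic:
  "exec c s t s' \<Longrightarrow> exec c s u s'' \<Longrightarrow> u = t \<and> s'' = s'"
proof (induction arbitrary: u s'' rule: exec.induct)
  case exec_Skip
  from exec_Skip.prems show ?case by (rule exec_SkipE) simp
next
  case exec_NAssign
  from exec_NAssign.prems show ?case by (rule exec_NAssignE) simp
next
  case exec_RAssign
  from exec_RAssign.prems show ?case by (rule exec_RAssignE) simp
next
  case (exec_Seq c s t s' d u' s2)
  from exec_Seq.prems obtain t1 t2 r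
    where r: "exec c s t1 r" "exec d r t2 s''" and u: "u = t1 + t2"
    by (rule exec_SeqE)
  from exec_Seq.IH(1)[OF r(1)] have t: "t1 = t" and s: "r = s'" by simp_all
  from exec_Seq.IH(2)[OF r(2)[unfolded s]] t u show ?case by simp
next
  case (exec_CondTrue b s c t s' d)
  from exec_CondTrue.prems obtain t1
    where r: "exec c s t1 s''" and u: "u = Suc (bcost b + t1)"
    by (rule exec_CondE) (use exec_CondTrue.hyps in blast)+
  from exec_CondTrue.IH[OF r] u show ?case by simp
next
  case (exec_CondFalse b s d t s' c)
  from exec_CondFalse.prems obtain t1
    where r: "exec d s t1 s''" and u: "u = Suc (bcost b + t1)"
    by (rule exec_CondE) (use exec_CondFalse.hyps in blast)+
  from exec_CondFalse.IH[OF r] u show ?case by simp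
next
  case (exec_WhileFalse b s c)
  from exec_WhileFalse.prems show ?case
    by (rule exec_WhileE) (use exec_WhileFalse.hyps in simp_all)
next
  case (exec_WhileTrue b s c t s' u' s2)
  from exec_WhileTrue.prems obtain t1 t2 r
    where r: "exec c s t1 r" "exec (While b c) r t2 s''" and u: "u = Suc (bcost b + t1 + t2)"
    by (rule exec_WhileE) (use exec_WhileTrue.hyps in blast)+
  from exec_WhileTrue.IH(1)[OF r(1)] have t: "t1 = t" and s: "r = s'" by simp_all
  from exec_WhileTrue.IH(2)[OF r(2)[unfolded s]] t u show ?case by simp
qed


section \<open>The maximum weight clique problem\<close>

text \<open>
  Input graphs have vertex set \<open>{..<n}\<close>. The machine receives \<open>n\<close>, the adjacency matrix and
  the vector of weights; all other cells are zero.
\<close>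

definition mwc_input :: "nat graph \<Rightarrow> (nat \<Rightarrow> real) \<Rightarrow> store" where
  "mwc_input G w =
     \<lparr>nat_cell = (\<lambda>a i j.
        if a = ''n'' \<and> i = 0 \<and> j = 0 then card (verts G)
        else if a = ''adj'' \<and> adj G i j then 1
        else 0),
      real_cell = (\<lambda>a i j. if a = ''w'' \<and> i \<in> verts G \<and> j = 0 then w i else 0)\<rparr>"

text \<open>The answer is the set with characteristic vector \<open>out[v, 0]\<close>, \<open>v < n\<close>.\<close>

definition mwc_output :: "nat graph \<Rightarrow> store \<Rightarrow> nat set" where
  "mwc_output G s = {v \<in> verts G. nat_cell s ''out'' v 0 = 1}"

definition solves_mwc_in_time :: "com \<Rightarrow> nat graph set \<Rightarrow> (nat \<Rightarrow> nat) \<Rightarrow> bool" where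
  "solves_mwc_in_time P \<G> T \<longleftrightarrow>
     (\<forall>G \<in> \<G>. \<forall>w. simple_graph G \<and> verts G = {..<card (verts G)} \<longrightarrow>
        (\<exists>t s. exec P (mwc_input G w) t s \<and> t \<le> T (card (verts G)) \<and>
               max_weight_clique G w (mwc_output G s)))"

end

theory Submission
  imports Defs
begin

text \<open>
  Only the exclusion of \<open>C\<^sub>4\<close> and \<open>C\<^sub>5\<close> matters. If \<open>d\<close> and \<open>e\<close> are adjacent and neither is adjacent
  to \<open>x\<close>, then \<open>N(x) \<inter> N(d)\<close> and \<open>N(x) \<inter> N(e)\<close> are comparable cliques. Order the non-neighbours of
  \<open>x\<close> by decreasing \<open>|N(x) \<inter> N(d)|\<close>, ties by index. Given a maximal clique \<open>K\<close>, let \<open>x\<close> be a vertex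
  outside \<open>K\<close> with the most neighbours in \<open>K\<close> and \<open>d\<close> the last vertex of \<open>K - N(x)\<close>. A vertex outside
  \<open>K\<close> which is a neighbour of \<open>d\<close> preceding \<open>d\<close> would have more neighbours in \<open>K\<close> than \<open>x\<close>; hence \<open>K\<close>
  consists of \<open>d\<close>, the preceding neighbours of \<open>d\<close>, and \<open>N(x) \<inter> N(d)\<close>. This leaves at most
  \<open>n(n + 1)\<close> candidates, each weighed in time \<open>O(n)\<close>. Negative weights are harmless: the vertices
  of positive weight in a maximal clique are kept, the others are dropped.
\<close>

section \<open>Timed weakest preconditions\<close>

text \<open>Termination within the budget is asserted, not assumed. \<open>B\<close> is only an
  upper bound, so budgets can be rounded up.\<close>

definition runs :: "com \<Rightarrow> store \<Rightarrow> nat \<Rightarrow> (store \<Rightarrow> bool) \<Rightarrow> bool" where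
  "runs c s B Q \<longleftrightarrow> (\<exists>t s'. exec c s t s' \<and> t \<le> B \<and> Q s')"

text \<open>By determinism one known execution decides the triple, so atomic commands are handled by
  rewriting.\<close>

lemma runs_exec:
  assumes "exec c s t s'"
  shows "runs c s B Q \<longleftrightarrow> t \<le> B \<and> Q s'"
  unfolding runs_def using assms exec_deterministic by blast

lemmas runs_Skip [simp] = runs_exec[OF exec_Skip]
  and runs_NAssign [simp] = runs_exec[OF exec_NAssign]
  and runs_RAssign [simp] = runs_exec[OF exec_RAssign]

lemma runs_Seq:
  assumes "runs c s b (\<lambda>s'. runs d s' b' Q)" and "b + b' \<le> B"
  shows "runs (Seq c d) s B Q"
proof -
  obtain t s' u s'' where "exec c s t s'" "t \<le> b" "exec d s' u s''" "u \<le> b'" "Q s''"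
    using assms(1) unfolding runs_def by blast
  with assms(2) show ?thesis
    unfolding runs_def by (intro exI[of _ "t + u"] exI[of _ s'']) (auto intro: exec_Seq)
qed

lemma runs_Seq_NAssign:
  assumes "1 + ncost i + ncost j + ncost e \<le> B"
    and "runs d (nat_write a (nval i s) (nval j s) (nval e s) s)
           (B - (1 + ncost i + ncost j + ncost e)) Q"
  shows "runs (Seq (NAssign a i j e) d) s B Q"
  by (rule runs_Seq[where b = "1 + ncost i + ncost j + ncost e"]) (use assms in auto)

lemma runs_Seq_RAssign:
  assumes "1 + ncost i + ncost j + rcost e \<le> B"
    and "runs d (real_write a (nval i s) (nval j s) (rval e s) s)
           (B - (1 + ncost i + ncost j + rcost e)) Q"
  shows "runs (Seq (RAssign a i j e) d) s B Q"
  by (rule runs_Seq[where b = "1 + ncost i + ncost j + rcost e"]) (use assms in auto)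

lemma runs_Cond:
  assumes "1 + bcost b \<le> B"
    and "bval b s \<Longrightarrow> runs c s (B - (1 + bcost b)) Q"
    and "\<not> bval b s \<Longrightarrow> runs d s (B - (1 + bcost b)) Q"
  shows "runs (Cond b c d) s B Q"
proof (cases "bval b s")
  case True
  then obtain t s' where "exec c s t s'" "t \<le> B - (1 + bcost b)" "Q s'"
    using assms(2) unfolding runs_def by blast
  with True assms(1) show ?thesis
    unfolding runs_def
    by (intro exI[of _ "1 + bcost b + t"] exI[of _ s']) (auto intro: exec_CondTrue[simplified])
next
  case False
  then obtain t s' where "exec d s t s'" "t \<le> B - (1 + bcost b)" "Q s'"
    using assms(3) unfolding runs_def by blast
  with False assms(1) show ?thesis
    unfolding runs_def
    by (intro exI[of _ "1 + bcost b + t"] exI[of _ s']) (auto intro: exec_CondFalse[simplified])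
qed

lemma runs_mono:
  assumes "runs c s b Q" and "b \<le> B" and "\<And>s'. Q s' \<Longrightarrow> R s'"
  shows "runs c s B R"
  using assms unfolding runs_def by (meson le_trans)

lemma nat_cell_nat_write [simp]:
  "nat_cell (nat_write a i j x s) a' i' j' =
     (if a' = a \<and> i' = i \<and> j' = j then x else nat_cell s a' i' j')"
  "real_cell (nat_write a i j x s) = real_cell s"
  by (simp_all add: nat_write_def)

lemma nat_cell_nat_write_other [simp]:
  "a' \<noteq> a \<Longrightarrow> nat_cell (nat_write a i j x s) a' = nat_cell s a'"
  by (simp add: nat_write_def)

lemma real_cell_real_write [simp]:
  "real_cell (real_write a i j x s) a' i' j' =
     (if a' = a \<and> i' = i \<and> j' = j then x else real_cell s a' i' j')"
  "nat_cell (real_write a i j x s) = nat_cell s"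
  by (simp_all add: real_write_def)

lemma real_cell_real_write_other [simp]:
  "a' \<noteq> a \<Longrightarrow> real_cell (real_write a i j x s) a' = real_cell s a'"
  by (simp add: real_write_def)

section \<open>Frames: arrays that a command leaves unchanged\<close>

primrec nat_writes :: "com \<Rightarrow> string set" where
  "nat_writes Skip = {}"
| "nat_writes (NAssign a i j e) = {a}"
| "nat_writes (RAssign a i j e) = {}"
| "nat_writes (Seq c d) = nat_writes c \<union> nat_writes d"
| "nat_writes (Cond b c d) = nat_writes c \<union> nat_writes d"
| "nat_writes (While b c) = nat_writes c"

primrec real_writes :: "com \<Rightarrow> string set" where
  "real_writes Skip = {}"
| "real_writes (NAssign a i j e) = {}"
| "real_writes (RAssign a i j e) = {a}"
| "real_writes (Seq c d) = real_writes c \<union> real_writes d"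
| "real_writes (Cond b c d) = real_writes c \<union> real_writes d"
| "real_writes (While b c) = real_writes c"

text \<open>Whole arrays are compared: writing one cell already gives up the claim for the entire
  array.\<close>

definition agree_off :: "string set \<Rightarrow> string set \<Rightarrow> store \<Rightarrow> store \<Rightarrow> bool" where
  "agree_off N R s s' \<longleftrightarrow>
     (\<forall>a. a \<notin> N \<longrightarrow> nat_cell s' a = nat_cell s a) \<and>
     (\<forall>a. a \<notin> R \<longrightarrow> real_cell s' a = real_cell s a)"

lemma agree_off_nat: "agree_off N R s s' \<Longrightarrow> a \<notin> N \<Longrightarrow> nat_cell s' a = nat_cell s a"
  and agree_off_real: "agree_off N R s s' \<Longrightarrow> a \<notin> R \<Longrightarrow> real_cell s' a = real_cell s a"
  by (simp_all add: agree_off_def)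

lemma exec_agree_off: "exec c s t s' \<Longrightarrow> agree_off (nat_writes c) (real_writes c) s s'"
  by (induction rule: exec.induct) (auto simp: agree_off_def)

lemma runs_frame:
  assumes "runs c s B Q"
    and "\<And>s'. Q s' \<Longrightarrow> agree_off (nat_writes c) (real_writes c) s s' \<Longrightarrow> R s'"
  shows "runs c s B R"
  using assms unfolding runs_def by (meson exec_agree_off)

section \<open>Counting loops\<close>

abbreviation scalar :: "string \<Rightarrow> nexp" where
  "scalar a \<equiv> NCell a (NConst 0) (NConst 0)"

definition For :: "string \<Rightarrow> string \<Rightarrow> com \<Rightarrow> com" where
  "For v u c = Seq (NAssign v (NConst 0) (NConst 0) (NConst 0))
     (While (NLess (scalar v) (scalar u))
        (Seq c (NAssign v (NConst 0) (NConst 0) (NSucc (scalar v)))))"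

lemma writes_For [simp]:
  "nat_writes (For v u c) = insert v (nat_writes c)"
  "real_writes (For v u c) = real_writes c"
  by (auto simp: For_def)

text \<open>Induction on the remaining turns \<open>N - k\<close>. Besides the body, a turn costs 8
  for the test and 7 for the increment; the failing last test costs 8. Since the increment follows
  the body, the invariant must not depend on the counter cell.\<close>

lemma runs_While_count:
  assumes fresh: "v \<notin> nat_writes c" "u \<notin> nat_writes c" "u \<noteq> v"
    and step: "\<And>k s'. k < N \<Longrightarrow> I k s' \<Longrightarrow> nat_cell s' v 0 0 = k \<Longrightarrow>
        agree_off (insert v (nat_writes c)) (real_writes c) s s' \<Longrightarrow> runs c s' b (I (Suc k))"
    and indep: "\<And>k x s'. I k s' \<Longrightarrow> I k (nat_write v 0 0 x s')"
    and N: "nat_cell s u 0 0 = N"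
    and start: "k \<le> N" "I k s'" "nat_cell s' v 0 0 = k"
      "agree_off (insert v (nat_writes c)) (real_writes c) s s'"
  shows "runs (While (NLess (scalar v) (scalar u))
        (Seq c (NAssign v (NConst 0) (NConst 0) (NSucc (scalar v))))) s' ((N - k) * (b + 15) + 8)
        (\<lambda>s''. I N s'' \<and> agree_off (insert v (nat_writes c)) (real_writes c) s s'')"
  using start
proof (induction "N - k" arbitrary: k s')
  case 0
  have "nat_cell s' u 0 0 = N"
    using agree_off_nat[OF 0(5)] fresh N by simp
  with 0 have "\<not> bval (NLess (scalar v) (scalar u)) s'" "k = N" by auto
  with 0 show ?case unfolding runs_def
    using exec_WhileFalse[of "NLess (scalar v) (scalar u)" s'] by fastforce
next
  case (Suc m)
  let ?A = "agree_off (insert v (nat_writes c)) (real_writes c)"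
  let ?b = "NLess (scalar v) (scalar u)"
  let ?d = "Seq c (NAssign v (NConst 0) (NConst 0) (NSucc (scalar v)))"
  have uN: "nat_cell s' u 0 0 = N"
    using agree_off_nat[OF Suc(6)] fresh N by simp
  with Suc have b: "bval ?b s'" and k: "k < N" by auto
  from step[OF k Suc(4,5,6)] obtain t s1
    where 1: "exec c s' t s1" "t \<le> b" "I (Suc k) s1" unfolding runs_def by blast
  have a1: "agree_off (nat_writes c) (real_writes c) s' s1" by (rule exec_agree_off[OF 1(1)])
  define s2 where "s2 = nat_write v 0 0 (Suc k) s1"
  have v1: "nat_cell s1 v 0 0 = k" using agree_off_nat[OF a1 fresh(1)] Suc by simp
  have e2: "exec ?d s' (t + 7) s2"
    using exec_Seq[OF 1(1) exec_NAssign[of v "NConst 0" "NConst 0" "NSucc (scalar v)"]] v1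
    by (simp add: s2_def numeral_eq_Suc)
  have a2: "?A s s2"
    using Suc(6) a1 unfolding agree_off_def s2_def by auto
  have "runs (While ?b ?d) s2 ((N - Suc k) * (b + 15) + 8) (\<lambda>s''. I N s'' \<and> ?A s s'')"
    by (rule Suc(1)) (use Suc k 1(3) indep a2 in \<open>auto simp: s2_def\<close>)
  then obtain t3 s3 where 3: "exec (While ?b ?d) s2 t3 s3"
    "t3 \<le> (N - Suc k) * (b + 15) + 8" "I N s3" "?A s s3" unfolding runs_def by blast
  have e: "exec (While ?b ?d) s' (1 + bcost ?b + (t + 7) + t3) s3"
    by (rule exec_WhileTrue[OF b e2 3(1)])
  have "N - k = Suc (N - Suc k)" using k by simp
  then have "1 + bcost ?b + (t + 7) + t3 \<le> (N - k) * (b + 15) + 8"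
    using 3(2) 1(2) by simp
  with e 3 show ?case unfolding runs_def by blast
qed

lemma runs_For:
  assumes "v \<notin> nat_writes c" "u \<notin> nat_writes c" "u \<noteq> v"
    and "nat_cell s u 0 0 = N"
    and "I 0 s"
    and "\<And>k x s'. I k s' \<Longrightarrow> I k (nat_write v 0 0 x s')"
    and "\<And>k s'. k < N \<Longrightarrow> I k s' \<Longrightarrow> nat_cell s' v 0 0 = k \<Longrightarrow>
        agree_off (insert v (nat_writes c)) (real_writes c) s s' \<Longrightarrow> runs c s' b (I (Suc k))"
    and "\<And>s'. I N s' \<Longrightarrow> agree_off (insert v (nat_writes c)) (real_writes c) s s' \<Longrightarrow> Q s'"
    and "N * (b + 15) + 12 \<le> B"
  shows "runs (For v u c) s B Q"
  unfolding For_def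
proof (rule runs_Seq)
  show "4 + (N * (b + 15) + 8) \<le> B" using assms by simp
  let ?s = "nat_write v 0 0 0 s"
  have "runs (While (NLess (scalar v) (scalar u))
        (Seq c (NAssign v (NConst 0) (NConst 0) (NSucc (scalar v))))) ?s ((N - 0) * (b + 15) + 8)
        (\<lambda>s''. I N s'' \<and> agree_off (insert v (nat_writes c)) (real_writes c) s s'')"
    by (rule runs_While_count) (use assms in \<open>auto simp: agree_off_def\<close>)
  then have "runs (While (NLess (scalar v) (scalar u))
        (Seq c (NAssign v (NConst 0) (NConst 0) (NSucc (scalar v))))) ?s (N * (b + 15) + 8) Q"
    by (rule runs_mono) (use assms in auto)
  then show "runs (NAssign v (NConst 0) (NConst 0) (NConst 0)) s 4
     (\<lambda>s'. runs (While (NLess (scalar v) (scalar u))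
        (Seq c (NAssign v (NConst 0) (NConst 0) (NSucc (scalar v))))) s' (N * (b + 15) + 8) Q)"
    by simp
qed


section \<open>Maximal cliques of graphs without induced cycles of length 4 and 5\<close>

text \<open>The exclusions in chord form. For 4-cycles only opposite vertices are required to
  differ; consecutive ones do so by irreflexivity.\<close>

locale C4_C5_free =
  fixes A :: "nat \<Rightarrow> nat \<Rightarrow> bool" and n :: nat
  assumes sym: "A a b \<Longrightarrow> A b a"
    and irrefl: "\<not> A a a"
    and bound: "A a b \<Longrightarrow> a < n"
    and C4: "\<lbrakk>A a b; A b c; A c d; A d a; a \<noteq> c; b \<noteq> d\<rbrakk> \<Longrightarrow> A a c \<or> A b d"
    and C5: "\<lbrakk>A a b; A b c; A c d; A d e; A e a; distinct [a, b, c, d, e]\<rbrakk> \<Longrightarrow>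
      A a c \<or> A b d \<or> A c e \<or> A d a \<or> A e b"
begin

definition cliq :: "nat set \<Rightarrow> bool" where
  "cliq K \<longleftrightarrow> K \<subseteq> {..<n} \<and> (\<forall>u\<in>K. \<forall>v\<in>K. u \<noteq> v \<longrightarrow> A u v)"

definition common :: "nat \<Rightarrow> nat \<Rightarrow> nat set" where
  "common x d = {y. y < n \<and> A d y \<and> A x y}"

definition before :: "nat \<Rightarrow> nat \<Rightarrow> nat \<Rightarrow> bool" where
  "before x e d \<longleftrightarrow>
     card (common x d) < card (common x e) \<or> card (common x e) = card (common x d) \<and> e < d"

text \<open>The conditions on \<open>d\<close> make the set empty for \<open>x\<close> and its
  neighbours, so it can be tabulated for every \<open>d\<close>.\<close>

definition preds :: "nat \<Rightarrow> nat \<Rightarrow> nat set" where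
  "preds x d = {e. e < n \<and> d \<noteq> x \<and> \<not> A x d \<and> e \<noteq> x \<and> \<not> A x e \<and> A d e \<and> before x e d}"

text \<open>
  If \<open>p\<close> is a parent of \<open>d\<close> with \<open>preds x p \<subseteq> preds x d\<close>, then \<open>preds x d = insert p (preds x p)\<close>.
  Applied to \<open>d\<close> and all its predecessors, this certifies a clique without testing all pairs. The
  machine examines a single parent of \<open>d\<close>, whose choice is left open: its verdict lies between
  \<open>strong_ok\<close> and \<open>weak_ok\<close>.
\<close>

definition parent :: "nat \<Rightarrow> nat \<Rightarrow> nat \<Rightarrow> bool" where
  "parent x d p \<longleftrightarrow> p \<in> preds x d \<and> card (preds x p) + 1 = card (preds x d)"

definition weak_ok :: "nat \<Rightarrow> nat \<Rightarrow> bool" where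
  "weak_ok x d \<longleftrightarrow> preds x d = {} \<or> (\<exists>p. parent x d p \<and> preds x p \<subseteq> preds x d)"

definition strong_ok :: "nat \<Rightarrow> nat \<Rightarrow> bool" where
  "strong_ok x d \<longleftrightarrow> preds x d = {} \<or>
     (\<exists>p. parent x d p) \<and> (\<forall>p. parent x d p \<longrightarrow> preds x p \<subseteq> preds x d)"

definition cand :: "nat \<Rightarrow> nat \<Rightarrow> nat set" where
  "cand x d = insert d (preds x d) \<union> common x d"

section \<open>Certified candidates are cliques\<close>

lemma finite_common [simp]: "finite (common x d)"
  and finite_preds [simp]: "finite (preds x d)"
  by (simp_all add: common_def preds_def)

lemma cand_subset: "d < n \<Longrightarrow> cand x d \<subseteq> {..<n}"
  by (auto simp: cand_def preds_def common_def)

text \<open>Let \<open>y\<close> and \<open>z\<close> witness incomparability. If they are adjacent,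
  \<open>y d e z\<close> is an induced 4-cycle; otherwise \<open>x y d e z\<close> is an induced
  5-cycle.\<close>

lemma common_comparable:
  assumes de: "A d e" and x: "d \<noteq> x" "e \<noteq> x" "\<not> A x d" "\<not> A x e"
  shows "common x d \<subseteq> common x e \<or> common x e \<subseteq> common x d"
proof (rule ccontr)
  assume "\<not> ?thesis"
  then obtain y z where y: "A d y" "A x y" "\<not> A e y" and z: "A e z" "A x z" "\<not> A d z"
    unfolding common_def by blast
  have "y \<noteq> z" "y \<noteq> e" "d \<noteq> z" using y z x by auto
  then have nyz: "\<not> A y z"
    using C4[of y d e z] de y z sym by blast
  have "distinct [x, y, d, e, z]"
    using de x y z irrefl by auto
  then show False
    using C5[of x y d e z] de x y z nyz sym by blast
qed

text \<open>Comparability upgrades an inequality of sizes to an inclusion, which is why sorting by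
  \<open>card (common x d)\<close> is useful.\<close>

lemma common_mono:
  assumes "A d e" "d \<noteq> x" "e \<noteq> x" "\<not> A x d" "\<not> A x e"
    and "card (common x d) \<le> card (common x e)"
  shows "common x d \<subseteq> common x e"
  using common_comparable[OF assms(1-5)] assms(6)
  by (metis card_seteq finite_common order_refl)

text \<open>Two non-adjacent members would form an induced 4-cycle with the non-adjacent
  \<open>d\<close> and \<open>x\<close>.\<close>

lemma common_clique:
  assumes "d \<noteq> x" "\<not> A x d" "y \<in> common x d" "z \<in> common x d" "y \<noteq> z"
  shows "A y z"
  using C4[of d y x z] assms sym unfolding common_def by blast

text \<open>Strong induction on the number of predecessors: those of \<open>d\<close> are a parent
  and the parent's own predecessors, a clique by induction.\<close>

lemma preds_clique:
  assumes "d < n" "\<forall>e\<in>insert d (preds x d). weak_ok x e"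
  shows "cliq (insert d (preds x d))"
  using assms
proof (induction "card (preds x d)" arbitrary: d rule: less_induct)
  case less
  show ?case
  proof (cases "preds x d = {}")
    case True
    with less show ?thesis by (auto simp: cliq_def)
  next
    case False
    then obtain p where p: "p \<in> preds x d" "card (preds x p) + 1 = card (preds x d)"
      "preds x p \<subseteq> preds x d"
      using less unfolding weak_ok_def parent_def by blast
    \<comment> \<open>As \<open>p\<close> is not its own predecessor, the inclusion and the sizes
      force equality.\<close>
    have "p \<notin> preds x p" using irrefl by (simp add: preds_def)
    then have eq: "insert p (preds x p) = preds x d"
      using p by (intro card_subset_eq) auto
    have "cliq (insert p (preds x p))"
      by (rule less(1)) (use less p in \<open>auto simp: preds_def\<close>)
    then have "cliq (preds x d)" by (simp only: eq)
    moreover have "A d e" if "e \<in> preds x d" for e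
      using that by (simp add: preds_def)
    ultimately show ?thesis using less(2) sym unfolding cliq_def by auto
  qed
qed

text \<open>A predecessor of \<open>d\<close> has at least as many common neighbours with
  \<open>x\<close>, so by \<open>common_mono\<close> it is adjacent to all of
  \<open>common x d\<close>.\<close>

lemma cand_clique:
  assumes d: "d < n" "d \<noteq> x" "\<not> A x d" and ok: "\<forall>e\<in>insert d (preds x d). weak_ok x e"
  shows "cliq (cand x d)"
proof -
  have c: "cliq (insert d (preds x d))" using preds_clique[OF d(1) ok] .
  have "A e y" if e: "e \<in> insert d (preds x d)" and y: "y \<in> common x d" for e y
  proof (cases "e = d")
    case True
    with y show ?thesis by (simp add: common_def)
  next
    case False
    with e have "A d e" "e \<noteq> x" "\<not> A x e" "card (common x d) \<le> card (common x e)"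
      by (auto simp: preds_def before_def)
    then have "common x d \<subseteq> common x e" using common_mono d by blast
    with y show ?thesis by (auto simp: common_def)
  qed
  moreover have "A y z" if "y \<in> common x d" "z \<in> common x d" "y \<noteq> z" for y z
    using common_clique d that by blast
  moreover have "cand x d \<subseteq> {..<n}" using cand_subset d by blast
  ultimately show ?thesis
    using c sym unfolding cliq_def cand_def by (metis Un_iff)
qed

section \<open>Maximal cliques are certified candidates\<close>

lemma before_last:
  assumes "finite D" "D \<noteq> {}"
  obtains d where "d \<in> D" "\<And>e. e \<in> D \<Longrightarrow> e \<noteq> d \<Longrightarrow> before x e d"
proof -
  \<comment> \<open>The last element has the fewest common neighbours with \<open>x\<close> and,
    among those, the largest index.\<close>
  define f where "f = (\<lambda>e. card (common x e))"
  define m where "m = Min (f ` D)"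
  define E where "E = {e \<in> D. f e = m}"
  have "m \<in> f ` D" unfolding m_def using assms by (intro Min_in) auto
  then have E: "finite E" "E \<noteq> {}" using assms unfolding E_def by auto
  have "before x e (Max E)" if e: "e \<in> D" "e \<noteq> Max E" for e
  proof -
    have M: "f (Max E) = m" using Max_in[OF E] by (simp add: E_def)
    have "m \<le> f e" unfolding m_def using assms e by simp
    moreover have "e < Max E" if "f e = m"
      using Max_ge[OF E(1), of e] that e by (auto simp: E_def)
    ultimately show ?thesis unfolding before_def using M f_def by fastforce
  qed
  then show ?thesis using that[of "Max E"] Max_in[OF E] by (auto simp: E_def)
qed

text \<open>
  The vertex \<open>x\<close> is chosen outside \<open>K\<close> with as many neighbours in \<open>K\<close> as possible. The index \<open>n\<close>
  plays the role of an additional isolated vertex, so that such an \<open>x\<close> exists even if \<open>K\<close>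
  contains all vertices.
\<close>

lemma maximal_clique_is_cand:
  assumes K: "cliq K" "K \<noteq> {}" and maximal: "\<And>L. cliq L \<Longrightarrow> K \<subseteq> L \<Longrightarrow> L = K"
  obtains x d where "x \<le> n" "d < n" "d \<noteq> x" "\<not> A x d"
    "\<forall>e\<in>insert d (preds x d). strong_ok x e" "cand x d = K"
proof -
  have KV: "K \<subseteq> {..<n}" and KA: "\<And>u v. u \<in> K \<Longrightarrow> v \<in> K \<Longrightarrow> u \<noteq> v \<Longrightarrow> A u v"
    using K by (auto simp: cliq_def)
  have finK: "finite K" using KV finite_subset by blast
  have extend: "y \<in> K" if "y < n" "\<And>u. u \<in> K \<Longrightarrow> u \<noteq> y \<Longrightarrow> A u y" for y
  proof -
    have "cliq (insert y K)"
      using K that sym unfolding cliq_def by auto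
    then show ?thesis using maximal by blast
  qed
  define deg where "deg = (\<lambda>x. card {u \<in> K. A x u})"
  have ne: "n \<in> {..n} - K" using KV by auto
  obtain x where x: "x \<in> {..n} - K" "\<And>e. e \<in> {..n} - K \<Longrightarrow> deg e \<le> deg x"
  proof -
    have fin: "finite (deg ` ({..n} - K))" by simp
    have "Max (deg ` ({..n} - K)) \<in> deg ` ({..n} - K)"
      using ne by (intro Max_in[OF fin]) blast
    then obtain x where "x \<in> {..n} - K" "deg x = Max (deg ` ({..n} - K))" by auto
    then show ?thesis using that[of x] Max_ge[OF fin] by auto
  qed
  have xK: "x \<notin> K" using x by simp
  define D where "D = {d \<in> K. \<not> A x d}"
  have Dne: "D \<noteq> {}"
  proof
    assume "D = {}"
    then have all: "A x u" if "u \<in> K" for u using that by (auto simp: D_def)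
    \<comment> \<open>Having a neighbour rules out the dummy index \<open>n\<close>.\<close>
    with K have "x < n" using bound by blast
    then have "x \<in> K" using extend all sym by blast
    with xK show False by simp
  qed
  have finD: "finite D" using finK by (simp add: D_def)
  have DK: "d < n" "d \<noteq> x" "\<not> A x d" "d \<in> K" if "d \<in> D" for d
    using that xK KV by (auto simp: D_def)
  \<comment> \<open>Otherwise \<open>e\<close> is adjacent to \<open>f\<close> and to every
    neighbour of \<open>x\<close> in \<open>K\<close>, against the choice of \<open>x\<close>. All
    \<open>f\<close> in \<open>D\<close> are covered, since the certificate concerns every
    predecessor of the last vertex.\<close>
  have preds_in: "e \<in> D" if f: "f \<in> D" and e: "e \<in> preds x f" for e f
  proof (rule ccontr)
    assume "e \<notin> D"
    moreover have e': "e < n" "e \<noteq> x" "\<not> A x e" "A f e" "card (common x f) \<le> card (common x e)"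
      using e by (auto simp: preds_def before_def)
    ultimately have eK: "e \<notin> K" by (auto simp: D_def)
    have "common x f \<subseteq> common x e"
      using common_mono e' DK[OF f] by blast
    moreover have "{u \<in> K. A x u} \<subseteq> common x f"
      using KA DK[OF f] KV unfolding common_def by auto
    ultimately have "{u \<in> K. A x u} \<subseteq> {u \<in> K. A e u}" by (auto simp: common_def)
    moreover have "f \<in> {u \<in> K. A e u}" "f \<notin> {u \<in> K. A x u}"
      using DK[OF f] e' sym by auto
    ultimately have "{u \<in> K. A x u} \<subset> {u \<in> K. A e u}" by blast
    then have "deg x < deg e"
      unfolding deg_def using finK by (intro psubset_card_mono) auto
    with x(2)[of e] eK e' show False by auto
  qed
  \<comment> \<open>Adjacency to \<open>f\<close> is automatic inside the clique, so predecessor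
    sets are initial segments of \<open>D\<close>.\<close>
  have preds_eq: "preds x f = {e \<in> D. before x e f}" if f: "f \<in> D" for f
  proof
    show "preds x f \<subseteq> {e \<in> D. before x e f}"
      using preds_in[OF f] by (auto simp: preds_def)
    have "A f e" if "e \<in> D" "before x e f" for e
      using KA[of f e] DK[OF f] DK[OF that(1)] that(2) by (auto simp: before_def)
    then show "{e \<in> D. before x e f} \<subseteq> preds x f"
      using DK[OF f] DK unfolding preds_def by auto
  qed
  have trans: "before x g f" if "before x g e" "before x e f" for e f g
    using that by (auto simp: before_def)
  \<comment> \<open>Initial segments are nested, so every parent passes the inclusion test, and the
    last predecessor is a parent.\<close>
  have strong: "strong_ok x f" if f: "f \<in> D" for f
  proof (cases "preds x f = {}")
    case False
    then obtain p where p: "p \<in> preds x f" "\<And>e. e \<in> preds x f \<Longrightarrow> e \<noteq> p \<Longrightarrow> before x e p"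
      using before_last finite_preds by metis
    have pD: "p \<in> D" "before x p f" using p(1) preds_eq[OF f] by auto
    have sub: "preds x e \<subseteq> preds x f" if "e \<in> preds x f" for e
      using that trans preds_eq[OF f] preds_eq[of e] by auto
    have "preds x f = insert p (preds x p)"
      using sub[OF p(1)] p preds_eq[OF f] preds_eq[OF pD(1)] by auto
    moreover have "p \<notin> preds x p" using irrefl by (simp add: preds_def)
    ultimately have "parent x f p"
      unfolding parent_def using p(1) by simp
    moreover have "preds x e \<subseteq> preds x f" if "parent x f e" for e
      using that sub by (simp add: parent_def)
    ultimately show ?thesis unfolding strong_ok_def by blast
  qed (simp add: strong_ok_def)
  obtain d where d: "d \<in> D" "\<And>e. e \<in> D \<Longrightarrow> e \<noteq> d \<Longrightarrow> before x e d"
    using before_last[OF finD Dne] by metis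
  have pd: "insert d (preds x d) = D"
    using d preds_eq[OF d(1)] by auto
  have "common x d = {u \<in> K. A x u}"
  proof
    show sub: "{u \<in> K. A x u} \<subseteq> common x d"
      using KA DK[OF d(1)] KV unfolding common_def by auto
    show "common x d \<subseteq> {u \<in> K. A x u}"
    proof
      fix y assume y: "y \<in> common x d"
      \<comment> \<open>For neighbours \<open>u\<close> of \<open>x\<close> this is
        \<open>common_clique\<close>; for \<open>u\<close> in \<open>D\<close> it is monotonicity,
        as \<open>d\<close> comes last. Maximality then puts \<open>y\<close> into
        \<open>K\<close>.\<close>
      have "A u y" if u: "u \<in> K" "u \<noteq> y" for u
      proof (cases "A x u")
        case True
        then show ?thesis using common_clique y sub u DK[OF d(1)] by blast
      next
        case False
        then have uD: "u \<in> D" using u by (simp add: D_def)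
        show ?thesis
        proof (cases "u = d")
          case True
          then show ?thesis using y by (simp add: common_def)
        next
          case False
          then have "A d u" "card (common x d) \<le> card (common x u)"
            using KA DK[OF d(1)] u d(2)[OF uD] by (auto simp: before_def)
          then have "common x d \<subseteq> common x u"
            using common_mono DK[OF d(1)] DK[OF uD] by blast
          then show ?thesis using y by (auto simp: common_def)
        qed
      qed
      then have "y \<in> K" using y extend by (simp add: common_def)
      with y show "y \<in> {u \<in> K. A x u}" by (simp add: common_def)
    qed
  qed
  then have "cand x d = K" unfolding cand_def pd by (auto simp: D_def)
  then show ?thesis
    using that[of x d] x DK[OF d(1)] strong pd by auto
qed

end

section \<open>The program\<close>

abbreviation vec :: "string \<Rightarrow> string \<Rightarrow> nexp" where
  "vec a i \<equiv> NCell a (scalar i) (NConst 0)"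

abbreviation mat :: "string \<Rightarrow> string \<Rightarrow> string \<Rightarrow> nexp" where
  "mat a i j \<equiv> NCell a (scalar i) (scalar j)"

abbreviation set_scalar :: "string \<Rightarrow> nexp \<Rightarrow> com" where
  "set_scalar a e \<equiv> NAssign a (NConst 0) (NConst 0) e"

abbreviation set_real :: "string \<Rightarrow> rexp \<Rightarrow> com" where
  "set_real a e \<equiv> RAssign a (NConst 0) (NConst 0) e"

abbreviation set_vec :: "string \<Rightarrow> string \<Rightarrow> nexp \<Rightarrow> com" where
  "set_vec a i e \<equiv> NAssign a (scalar i) (NConst 0) e"

abbreviation is_one :: "nexp \<Rightarrow> bexp" where
  "is_one e \<equiv> NEq e (NConst 1)"

abbreviation BOr :: "bexp \<Rightarrow> bexp \<Rightarrow> bexp" where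
  "BOr b c \<equiv> BNot (BAnd (BNot b) (BNot c))"

text \<open>
  For the current \<open>x\<close>, the arrays hold \<open>c[d] = card (common x d)\<close>, the characteristic function
  \<open>p[d, e]\<close> of \<open>preds x d\<close>, \<open>q[d] = card (preds x d)\<close>, the verdict \<open>ok[d]\<close>, and in \<open>m\<close> the vertices of
  positive weight of the current candidate.
\<close>

definition count_common :: com where
  "count_common = For ''d'' ''n''
     (Seq (set_scalar ''t'' (NConst 0))
     (Seq (For ''y'' ''n''
            (Cond (BAnd (is_one (mat ''adj'' ''d'' ''y'')) (is_one (mat ''adj'' ''x'' ''y'')))
               (set_scalar ''t'' (NSucc (scalar ''t''))) Skip))
       (set_vec ''c'' ''d'' (scalar ''t''))))"

definition is_pred :: bexp where
  "is_pred =
     BAnd (BNot (NEq (scalar ''d'') (scalar ''x'')))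
     (BAnd (BNot (is_one (mat ''adj'' ''x'' ''d'')))
     (BAnd (BNot (NEq (scalar ''e'') (scalar ''x'')))
     (BAnd (BNot (is_one (mat ''adj'' ''x'' ''e'')))
     (BAnd (is_one (mat ''adj'' ''d'' ''e''))
       (BOr (NLess (vec ''c'' ''d'') (vec ''c'' ''e''))
         (BAnd (NEq (vec ''c'' ''e'') (vec ''c'' ''d'')) (NLess (scalar ''e'') (scalar ''d''))))))))"

definition find_preds :: com where
  "find_preds = For ''d'' ''n''
     (Seq (set_scalar ''t'' (NConst 0))
     (Seq (For ''e'' ''n''
            (Cond is_pred
               (Seq (NAssign ''p'' (scalar ''d'') (scalar ''e'') (NConst 1))
                    (set_scalar ''t'' (NSucc (scalar ''t''))))
               (NAssign ''p'' (scalar ''d'') (scalar ''e'') (NConst 0))))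
       (set_vec ''q'' ''d'' (scalar ''t''))))"

text \<open>The value \<open>n\<close> in \<open>u\<close> means that no parent was found; among
  several parents the last one wins.\<close>

definition find_parent :: com where
  "find_parent = Seq (set_scalar ''u'' (scalar ''n''))
     (For ''e'' ''n''
        (Cond (BAnd (is_one (mat ''p'' ''d'' ''e'')) (NEq (NSucc (vec ''q'' ''e'')) (vec ''q'' ''d'')))
           (set_scalar ''u'' (scalar ''e'')) Skip))"

definition compare_preds :: com where
  "compare_preds = Seq (set_scalar ''t'' (NConst 1))
     (For ''e'' ''n''
        (Cond (BAnd (is_one (mat ''p'' ''u'' ''e'')) (BNot (is_one (mat ''p'' ''d'' ''e''))))
           (set_scalar ''t'' (NConst 0)) Skip))"

text \<open>Comparing with a single parent takes time O(n) for each \<open>d\<close>, which keeps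
  the work for one \<open>x\<close> quadratic.\<close>

definition check_preds :: com where
  "check_preds = For ''d'' ''n''
     (Seq find_parent
     (Seq (Cond (NEq (vec ''q'' ''d'') (NConst 0))
             (set_scalar ''t'' (NConst 1))
             (Cond (NLess (scalar ''u'') (scalar ''n''))
                compare_preds (set_scalar ''t'' (NConst 0))))
       (set_vec ''ok'' ''d'' (scalar ''t''))))"

text \<open>\<open>m\<close> is rewritten at every vertex, so nothing survives from the previous
  candidate; \<open>t\<close> collects the verdicts on \<open>d\<close> and its
  predecessors.\<close>

definition weigh_cand :: com where
  "weigh_cand = Seq (set_scalar ''t'' (NConst 1))
     (Seq (set_real ''sum'' RZero)
     (For ''e'' ''n''
        (Seq (Cond (BOr (BOr (NEq (scalar ''e'') (scalar ''d'')) (is_one (mat ''p'' ''d'' ''e'')))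
                     (BAnd (is_one (mat ''adj'' ''d'' ''e'')) (is_one (mat ''adj'' ''x'' ''e''))))
                (Cond (RLess RZero (RCell ''w'' (scalar ''e'') (NConst 0)))
                  (Seq (set_vec ''m'' ''e'' (NConst 1))
                     (set_real ''sum'' (RAdd (RCell ''sum'' (NConst 0) (NConst 0))
                                             (RCell ''w'' (scalar ''e'') (NConst 0)))))
                  (set_vec ''m'' ''e'' (NConst 0)))
                (set_vec ''m'' ''e'' (NConst 0)))
             (Cond (BAnd (BOr (NEq (scalar ''e'') (scalar ''d'')) (is_one (mat ''p'' ''d'' ''e'')))
                      (BNot (is_one (vec ''ok'' ''e''))))
                (set_scalar ''t'' (NConst 0)) Skip))))"

definition store_cand :: com where
  "store_cand = Seq (set_real ''best'' (RCell ''sum'' (NConst 0) (NConst 0)))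
     (For ''e'' ''n'' (set_vec ''out'' ''e'' (vec ''m'' ''e'')))"

definition improve :: com where
  "improve = For ''d'' ''n''
     (Seq weigh_cand
       (Cond (BAnd (BNot (NEq (scalar ''d'') (scalar ''x'')))
             (BAnd (BNot (is_one (mat ''adj'' ''x'' ''d'')))
             (BAnd (is_one (scalar ''t''))
               (RLess (RCell ''best'' (NConst 0) (NConst 0)) (RCell ''sum'' (NConst 0) (NConst 0))))))
          store_cand Skip))"

text \<open>The loop bound \<open>n + 1\<close> lets \<open>x\<close> reach the dummy index
  \<open>n\<close>.\<close>

definition mwc_program :: com where
  "mwc_program = Seq (set_scalar ''n1'' (NSucc (scalar ''n'')))
     (For ''x'' ''n1'' (Seq count_common (Seq find_preds (Seq check_preds improve))))"

section \<open>Correctness and cost of the subroutines\<close>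

lemma of_bool_eq_Suc_0 [simp]: "(of_bool P :: nat) = Suc 0 \<longleftrightarrow> P"
  by simp

lemma card_less_Suc:
  "card {y. y < Suc j \<and> P y} = card {y. y < j \<and> P y} + of_bool (P j)"
proof (cases "P j")
  case True
  then have "{y. y < Suc j \<and> P y} = insert j {y. y < j \<and> P y}" by (auto simp: less_Suc_eq)
  with True show ?thesis by simp
next
  case False
  then have "{y. y < Suc j \<and> P y} = {y. y < j \<and> P y}" by (auto simp: less_Suc_eq)
  with False show ?thesis by simp
qed

context C4_C5_free
begin

text \<open>The matrix is prescribed at all indices, not only below \<open>n\<close>, because
  \<open>x\<close> may equal \<open>n\<close>.\<close>

definition holds_input :: "(nat \<Rightarrow> real) \<Rightarrow> nat \<Rightarrow> store \<Rightarrow> bool" where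
  "holds_input w x s \<longleftrightarrow> nat_cell s ''n'' 0 0 = n \<and> nat_cell s ''adj'' = (\<lambda>i j. of_bool (A i j)) \<and>
     (\<forall>i<n. real_cell s ''w'' i 0 = w i) \<and> nat_cell s ''x'' 0 0 = x"

lemma holds_input_agree:
  assumes "holds_input w x s" "agree_off N R s s'" "''n'' \<notin> N" "''adj'' \<notin> N" "''x'' \<notin> N" "''w'' \<notin> R"
  shows "holds_input w x s'"
  using assms by (simp add: holds_input_def agree_off_def)

text \<open>An inner turn is allowed 200 units, or 215 with the loop overhead; the 100 absorbs the
  fixed cost of an outer turn. The later budgets are built likewise.\<close>

lemma runs_count_common:
  assumes inp: "holds_input w x s" and B: "n * (n * 215 + 100) + 12 \<le> B"
  shows "runs count_common s B (\<lambda>s'. \<forall>d<n. nat_cell s' ''c'' d 0 = card (common x d))"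
  unfolding count_common_def
proof (rule runs_For[where N = n and b = "n * 215 + 85"
      and I = "\<lambda>k s'. \<forall>d<k. nat_cell s' ''c'' d 0 = card (common x d)"], goal_cases)
  case (7 k s')
  have inp': "holds_input w x s'"
    by (rule holds_input_agree[OF inp 7(4)]) auto
  show ?case
  proof (rule runs_Seq_NAssign, simp, rule runs_Seq[where b = "n * 215 + 12" and b' = 50],
      rule runs_For[where N = n and b = 200
        and I = "\<lambda>j r. nat_cell r ''t'' 0 0 = card {y. y < j \<and> A k y \<and> A x y}"], goal_cases)
    case (7 j r)
    note fr = agree_off_nat[OF 7(4)]
    show ?case
      by (rule runs_Cond)
        (use 7 \<open>nat_cell s' ''d'' 0 0 = k\<close> inp' in \<open>auto simp: fr holds_input_def card_less_Suc\<close>)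
  next
    case (8 r)
    note fr = agree_off_nat[OF 8(2)]
    show ?case
      using 8(1) \<open>\<forall>d<k. _ d\<close> \<open>nat_cell s' ''d'' 0 0 = k\<close>
      by (auto simp: fr common_def All_less_Suc)
  qed (use inp' in \<open>auto simp: holds_input_def\<close>)
qed (use inp B in \<open>auto simp: holds_input_def algebra_simps\<close>)

lemma runs_find_preds:
  assumes inp: "holds_input w x s" and B: "n * (n * 215 + 100) + 12 \<le> B"
    and c: "\<forall>d<n. nat_cell s ''c'' d 0 = card (common x d)"
  shows "runs find_preds s B (\<lambda>s'. \<forall>d<n. (\<forall>e<n. nat_cell s' ''p'' d e = of_bool (e \<in> preds x d)) \<and>
     nat_cell s' ''q'' d 0 = card (preds x d))"
  unfolding find_preds_def
proof (rule runs_For[where N = n and b = "n * 215 + 85"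
      and I = "\<lambda>k s'. \<forall>d<k. (\<forall>e<n. nat_cell s' ''p'' d e = of_bool (e \<in> preds x d)) \<and>
     nat_cell s' ''q'' d 0 = card (preds x d)"], goal_cases)
  case (7 k s')
  have inp': "holds_input w x s'"
    by (rule holds_input_agree[OF inp 7(4)]) auto
  have c': "\<forall>d<n. nat_cell s' ''c'' d 0 = card (common x d)"
    using c agree_off_nat[OF 7(4)] by simp
  note k = \<open>k < n\<close> and d = \<open>nat_cell s' ''d'' 0 0 = k\<close> and IH = 7(2)
  show ?case
  \<comment> \<open>The inner loop writes to \<open>p\<close>, so the frame is silent about it and
    the invariant itself must preserve the rows below \<open>k\<close>.\<close>
  proof (rule runs_Seq_NAssign, simp, rule runs_Seq[where b = "n * 215 + 12" and b' = 50],
      rule runs_For[where N = n and b = 200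
        and I = "\<lambda>j r. (\<forall>e<j. nat_cell r ''p'' k e = of_bool (e \<in> preds x k)) \<and>
          nat_cell r ''t'' 0 0 = card {e. e < j \<and> e \<in> preds x k} \<and>
          (\<forall>d<k. \<forall>e. nat_cell r ''p'' d e = nat_cell s' ''p'' d e)"], goal_cases)
    case (7 j r)
    note fr = agree_off_nat[OF 7(4)]
    have cond: "bval is_pred r \<longleftrightarrow> j \<in> preds x k"
      using 7(1,3) inp' c' d k
      by (simp add: is_pred_def fr holds_input_def preds_def before_def)
    show ?case
      by (rule runs_Cond)
        (use 7 d cond in \<open>auto simp: fr card_less_Suc All_less_Suc is_pred_def[THEN arg_cong[of _ _ bcost]]
          intro!: runs_Seq_NAssign\<close>)
  next
    case (8 r)
    note fr = agree_off_nat[OF 8(2)]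
    have "{e. e < n \<and> e \<in> preds x k} = preds x k" by (auto simp: preds_def)
    then show ?case
      using 8(1) IH d by (auto simp: fr All_less_Suc)
  qed (use inp' in \<open>auto simp: holds_input_def\<close>)
qed (use inp B in \<open>auto simp: holds_input_def algebra_simps\<close>)

lemma runs_find_parent:
  assumes inp: "holds_input w x s" and B: "n * 215 + 50 \<le> B" and k: "k < n"
    and p: "\<forall>d<n. (\<forall>e<n. nat_cell s ''p'' d e = of_bool (e \<in> preds x d)) \<and>
     nat_cell s ''q'' d 0 = card (preds x d)" and d: "nat_cell s ''d'' 0 0 = k"
  shows "runs find_parent s B (\<lambda>s'. nat_cell s' ''u'' 0 0 = n \<and> (\<nexists>e. parent x k e) \<or>
     nat_cell s' ''u'' 0 0 < n \<and> parent x k (nat_cell s' ''u'' 0 0))"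
  unfolding find_parent_def
proof (rule runs_Seq_NAssign, use B in simp, rule runs_For[where N = n and b = 200
        and I = "\<lambda>j r. nat_cell r ''u'' 0 0 = n \<and> (\<forall>e<j. \<not> parent x k e) \<or>
          nat_cell r ''u'' 0 0 < n \<and> parent x k (nat_cell r ''u'' 0 0)"], goal_cases)
  case (7 j r)
  note fr = agree_off_nat[OF 7(4)]
  show ?case
    by (rule runs_Cond)
      (use 7(1-3) inp p d k in \<open>auto simp: fr holds_input_def parent_def All_less_Suc\<close>)
next
  case (8 r)
  then show ?case by (auto simp: parent_def preds_def)
qed (use inp B in \<open>auto simp: holds_input_def\<close>)

lemma runs_compare_preds:
  assumes inp: "holds_input w x s" and B: "n * 215 + 50 \<le> B" and k: "k < n"
    and p: "\<forall>d<n. (\<forall>e<n. nat_cell s ''p'' d e = of_bool (e \<in> preds x d))"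
    and d: "nat_cell s ''d'' 0 0 = k" and u: "nat_cell s ''u'' 0 0 = u" "u < n"
  shows "runs compare_preds s B (\<lambda>s'. nat_cell s' ''t'' 0 0 = of_bool (preds x u \<subseteq> preds x k))"
  unfolding compare_preds_def
proof (rule runs_Seq_NAssign, use B in simp, rule runs_For[where N = n and b = 200
        and I = "\<lambda>j r. nat_cell r ''t'' 0 0 = of_bool (\<forall>e<j. e \<in> preds x u \<longrightarrow> e \<in> preds x k)"], goal_cases)
  case (7 j r)
  note fr = agree_off_nat[OF 7(4)]
  show ?case
    by (rule runs_Cond)
      (use 7(1-3) inp p d k u in \<open>auto simp: fr holds_input_def All_less_Suc\<close>)
next
  case (8 r)
  have "(\<forall>e<n. e \<in> preds x u \<longrightarrow> e \<in> preds x k) \<longleftrightarrow> preds x u \<subseteq> preds x k"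
    by (auto simp: preds_def)
  with 8 show ?case by simp
qed (use inp B in \<open>auto simp: holds_input_def\<close>)

text \<open>When \<open>preds x d\<close> is nonempty, a parent that passes is a witness for
  \<open>weak_ok\<close>, while \<open>strong_ok\<close> ensures that a parent is found and passes,
  whichever it is.\<close>

lemma runs_check_preds:
  assumes inp: "holds_input w x s" and B: "n * (n * 430 + 300) + 12 \<le> B"
    and p: "\<forall>d<n. (\<forall>e<n. nat_cell s ''p'' d e = of_bool (e \<in> preds x d)) \<and>
     nat_cell s ''q'' d 0 = card (preds x d)"
  shows "runs check_preds s B (\<lambda>s'. \<forall>d<n. (nat_cell s' ''ok'' d 0 = 1 \<longrightarrow> weak_ok x d) \<and>
     (strong_ok x d \<longrightarrow> nat_cell s' ''ok'' d 0 = 1))"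
  unfolding check_preds_def
proof (rule runs_For[where N = n and b = "n * 430 + 285"
      and I = "\<lambda>k s'. \<forall>d<k. (nat_cell s' ''ok'' d 0 = 1 \<longrightarrow> weak_ok x d) \<and>
     (strong_ok x d \<longrightarrow> nat_cell s' ''ok'' d 0 = 1)"], goal_cases)
  case (7 k s')
  have inp': "holds_input w x s'"
    by (rule holds_input_agree[OF inp 7(4)]) (auto simp: find_parent_def compare_preds_def)
  have p': "\<forall>d<n. (\<forall>e<n. nat_cell s' ''p'' d e = of_bool (e \<in> preds x d)) \<and>
     nat_cell s' ''q'' d 0 = card (preds x d)"
    using p agree_off_nat[OF 7(4)] by (simp add: find_parent_def compare_preds_def)
  note k = \<open>k < n\<close> and d = \<open>nat_cell s' ''d'' 0 0 = k\<close> and IH = 7(2)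
  show ?case
  proof (rule runs_Seq[where b = "n * 215 + 50" and b' = "n * 215 + 234"], rule runs_frame,
      rule runs_find_parent[OF inp' order_refl k p' d], goal_cases)
    case (1 r)
    have inpr: "holds_input w x r"
      by (rule holds_input_agree[OF inp' 1(2)]) (auto simp: find_parent_def)
    have pr: "\<forall>d<n. (\<forall>e<n. nat_cell r ''p'' d e = of_bool (e \<in> preds x d)) \<and>
        nat_cell r ''q'' d 0 = card (preds x d)" and dr: "nat_cell r ''d'' 0 0 = k"
      and okr: "nat_cell r ''ok'' = nat_cell s' ''ok''"
      using p' d agree_off_nat[OF 1(2)] by (simp_all add: find_parent_def)
    let ?C = "Cond (NEq (vec ''q'' ''d'') (NConst 0)) (set_scalar ''t'' (NConst 1))
             (Cond (NLess (scalar ''u'') (scalar ''n''))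
                compare_preds (set_scalar ''t'' (NConst 0)))"
    have "runs ?C r (n * 215 + 150) (\<lambda>s'. (nat_cell s' ''t'' 0 0 = 1 \<longrightarrow> weak_ok x k) \<and>
       (strong_ok x k \<longrightarrow> nat_cell s' ''t'' 0 0 = 1))"
    proof (rule runs_Cond, goal_cases)
      case 2
      then have "preds x k = {}" using pr dr k by simp
      then show ?case by (simp add: weak_ok_def strong_ok_def)
    next
      case 3
      then have ne: "preds x k \<noteq> {}" using pr dr k by simp
      show ?case
      proof (rule runs_Cond, goal_cases)
        case 2
        then have u: "nat_cell r ''u'' 0 0 < n" using inpr by (simp add: holds_input_def)
        with 1 have par: "parent x k (nat_cell r ''u'' 0 0)" by simp
        show ?case
          by (rule runs_mono[OF runs_compare_preds[OF inpr order_refl k _ dr refl u]])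
            (use pr par ne in \<open>auto simp: weak_ok_def strong_ok_def\<close>)
      next
        case 3
        then have "\<nexists>e. parent x k e" using 1 inpr by (auto simp: holds_input_def)
        then show ?case using ne by (auto simp: strong_ok_def)
      qed simp
    qed simp
    then show ?case
    proof (rule runs_Seq[OF runs_frame, where b' = 50], goal_cases)
      case (1 r')
      note fr = agree_off_nat[OF 1(2)]
      show ?case using 1(1) IH
        by (auto simp: fr dr okr compare_preds_def All_less_Suc)
    next
      case 2
      show ?case by simp
    qed
  qed simp
qed (use inp B in \<open>auto simp: holds_input_def find_parent_def compare_preds_def algebra_simps\<close>)

lemma runs_weigh_cand:
  assumes inp: "holds_input w x s" and B: "n * 315 + 50 \<le> B" and k: "k < n"
    and p: "\<forall>d<n. (\<forall>e<n. nat_cell s ''p'' d e = of_bool (e \<in> preds x d))"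
    and d: "nat_cell s ''d'' 0 0 = k"
  shows "runs weigh_cand s B (\<lambda>s'.
     (\<forall>e<n. nat_cell s' ''m'' e 0 = of_bool (e \<in> cand x k \<and> 0 < w e)) \<and>
     real_cell s' ''sum'' 0 0 = (\<Sum>e\<in>cand x k. max 0 (w e)) \<and>
     nat_cell s' ''t'' 0 0 = of_bool (\<forall>e\<in>insert k (preds x k). nat_cell s ''ok'' e 0 = 1))"
  unfolding weigh_cand_def
proof (rule runs_Seq_NAssign, use B in simp, rule runs_Seq_RAssign, use B in simp,
    rule runs_For[where N = n and b = 300
      and I = "\<lambda>j r. (\<forall>e<j. nat_cell r ''m'' e 0 = of_bool (e \<in> cand x k \<and> 0 < w e)) \<and>
     real_cell r ''sum'' 0 0 = (\<Sum>e<j. of_bool (e \<in> cand x k) * max 0 (w e)) \<and>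
     nat_cell r ''t'' 0 0 =
       of_bool (\<forall>e<j. e \<in> insert k (preds x k) \<longrightarrow> nat_cell s ''ok'' e 0 = 1)"], goal_cases)
  case (7 j r)
  note fr = agree_off_nat[OF 7(4)] agree_off_real[OF 7(4)]
  have facts: "nat_cell r ''adj'' = (\<lambda>i j. of_bool (A i j))" "nat_cell r ''x'' 0 0 = x"
    "real_cell r ''w'' j 0 = w j" "nat_cell r ''p'' k j = of_bool (j \<in> preds x k)"
    "nat_cell r ''d'' 0 0 = k" "nat_cell r ''ok'' = nat_cell s ''ok''"
    using inp p d k 7(1) by (simp_all add: fr holds_input_def)
  have cand: "j \<in> cand x k \<longleftrightarrow> j = k \<or> j \<in> preds x k \<or> A k j \<and> A x j"
    using 7(1) by (auto simp: cand_def common_def)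
  show ?case
  \<comment> \<open>In the intermediate assertion \<open>m\<close> and \<open>sum\<close> have
    reached stage \<open>Suc j\<close>, while \<open>t\<close> is still at stage
    \<open>j\<close>.\<close>
  proof (rule runs_Seq[where b = 200 and b' = 100], rule runs_mono[where b = 200
      and Q = "\<lambda>r'. (\<forall>e<Suc j. nat_cell r' ''m'' e 0 = of_bool (e \<in> cand x k \<and> 0 < w e)) \<and>
     real_cell r' ''sum'' 0 0 = (\<Sum>e<Suc j. of_bool (e \<in> cand x k) * max 0 (w e)) \<and>
     nat_cell r' ''t'' 0 0 = nat_cell r ''t'' 0 0 \<and> nat_cell r' ''e'' 0 0 = j \<and>
     nat_cell r' ''d'' 0 0 = k \<and> nat_cell r' ''p'' = nat_cell r ''p'' \<and>
     nat_cell r' ''ok'' = nat_cell s ''ok''"], goal_cases)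
    case 1
    show ?case
    proof (rule runs_Cond, goal_cases)
      case 2
      then have c: "j \<in> cand x k" using 7(3) facts cand by auto
      show ?case
        by (rule runs_Cond) (use 7(2,3) facts c in \<open>auto simp: All_less_Suc intro!: runs_Seq_NAssign\<close>)
    next
      case 3
      then have c: "j \<notin> cand x k" using 7(3) facts cand by auto
      then show ?case
        using 7(2,3) facts by (auto simp: All_less_Suc)
    qed simp
  next
    case (3 r')
    show ?case
      by (rule runs_Cond) (use 3 7(2) facts in \<open>auto simp: All_less_Suc\<close>)
  qed simp_all
next
  case (8 r)
  have "(\<Sum>e<n. of_bool (e \<in> cand x k) * max 0 (w e)) = (\<Sum>e\<in>cand x k. max 0 (w e))"
    using cand_subset[OF k, of x] by (intro sum.mono_neutral_cong_right) auto
  moreover have "(\<forall>e<n. e \<in> insert k (preds x k) \<longrightarrow> nat_cell s ''ok'' e 0 = 1) \<longleftrightarrow>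
      (\<forall>e\<in>insert k (preds x k). nat_cell s ''ok'' e 0 = 1)"
    using k by (auto simp: preds_def)
  ultimately show ?case using 8 by simp
qed (use inp B in \<open>auto simp: holds_input_def\<close>)

section \<open>The running optimum\<close>

definition answer :: "store \<Rightarrow> nat set" where
  "answer s = {v. v < n \<and> nat_cell s ''out'' v 0 = 1}"

definition all_ok :: "nat \<Rightarrow> nat \<Rightarrow> bool" where
  "all_ok x d \<longleftrightarrow> d \<noteq> x \<and> \<not> A x d \<and> (\<forall>e\<in>insert d (preds x d). strong_ok x e)"

text \<open>The bound is claimed only for candidates passing \<open>strong_ok\<close>, which the
  machine is sure to certify; whatever else it accepts is a clique by \<open>weak_ok\<close>. Pairs
  are visited in lexicographic order.\<close>

definition best_before :: "(nat \<Rightarrow> real) \<Rightarrow> nat \<Rightarrow> nat \<Rightarrow> store \<Rightarrow> bool" where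
  "best_before w x k s \<longleftrightarrow> cliq (answer s) \<and> real_cell s ''best'' 0 0 = (\<Sum>v\<in>answer s. w v) \<and>
     (\<forall>y d. d < n \<longrightarrow> y < x \<or> y = x \<and> d < k \<longrightarrow> all_ok y d \<longrightarrow>
        (\<Sum>e\<in>cand y d. max 0 (w e)) \<le> real_cell s ''best'' 0 0)"

lemma best_before_cong:
  assumes "nat_cell s' ''out'' = nat_cell s ''out''" "real_cell s' ''best'' = real_cell s ''best''"
  shows "best_before w x k s' \<longleftrightarrow> best_before w x k s"
  using assms by (simp add: best_before_def answer_def)

lemma runs_store_cand:
  assumes inp: "holds_input w x s" and B: "n * 115 + 50 \<le> B"
  shows "runs store_cand s B (\<lambda>s'. real_cell s' ''best'' 0 0 = real_cell s ''sum'' 0 0 \<and>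
     (\<forall>e<n. nat_cell s' ''out'' e 0 = nat_cell s ''m'' e 0))"
  unfolding store_cand_def
proof (rule runs_Seq_RAssign, use B in simp, rule runs_For[where N = n and b = 100
      and I = "\<lambda>j r. \<forall>e<j. nat_cell r ''out'' e 0 = nat_cell s ''m'' e 0"], goal_cases)
  case (7 j r)
  note fr = agree_off_nat[OF 7(4)]
  show ?case using 7(1-3) by (auto simp: fr All_less_Suc)
next
  case (8 r)
  then show ?case by (simp add: agree_off_real[OF 8(2)])
qed (use inp B in \<open>auto simp: holds_input_def\<close>)

lemma runs_improve:
  assumes inp: "holds_input w x s" and B: "n * (n * 430 + 300) + 12 \<le> B"
    and p: "\<forall>d<n. (\<forall>e<n. nat_cell s ''p'' d e = of_bool (e \<in> preds x d))"
    and ok: "\<forall>d<n. (nat_cell s ''ok'' d 0 = 1 \<longrightarrow> weak_ok x d) \<and>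
       (strong_ok x d \<longrightarrow> nat_cell s ''ok'' d 0 = 1)"
    and best: "best_before w x 0 s"
  shows "runs improve s B (best_before w (Suc x) 0)"
  unfolding improve_def
proof (rule runs_For[where N = n and b = "n * 430 + 285" and I = "best_before w x"], goal_cases)
  case (7 k s')
  note writes = weigh_cand_def store_cand_def
  have inp': "holds_input w x s'"
    by (rule holds_input_agree[OF inp 7(4)]) (auto simp: writes)
  have p': "\<forall>d<n. (\<forall>e<n. nat_cell s' ''p'' d e = of_bool (e \<in> preds x d))"
    and ok': "nat_cell s' ''ok'' = nat_cell s ''ok''"
    using p agree_off_nat[OF 7(4)] by (simp_all add: writes)
  note k = \<open>k < n\<close> and d = \<open>nat_cell s' ''d'' 0 0 = k\<close> and IH = 7(2)
  have okk: "e < n" if "e \<in> insert k (preds x k)" for e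
    using that k by (auto simp: preds_def)
  show ?case
  proof (rule runs_Seq[where b = "n * 315 + 50" and b' = "n * 115 + 200"], rule runs_frame,
      rule runs_weigh_cand[OF inp' order_refl k p' d], goal_cases)
    case (1 r)
    note fr = agree_off_nat[OF 1(2)] agree_off_real[OF 1(2)]
    have inpr: "holds_input w x r"
      by (rule holds_input_agree[OF inp' 1(2)]) (auto simp: writes)
    have facts: "nat_cell r ''adj'' = (\<lambda>i j. of_bool (A i j))" "nat_cell r ''x'' 0 0 = x"
      using inpr by (simp_all add: holds_input_def)
    have dr: "nat_cell r ''d'' 0 0 = k" using d by (simp add: fr writes)
    have br: "best_before w x k r"
      using best_before_cong[of r s'] IH by (simp add: fr writes)
    show ?case
    proof (rule runs_Cond, goal_cases)
      case 2
      then have c: "k \<noteq> x" "\<not> A x k" "\<forall>e\<in>insert k (preds x k). nat_cell s ''ok'' e 0 = 1"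
        "real_cell r ''best'' 0 0 < real_cell r ''sum'' 0 0"
        using dr facts 1(1) ok' by (auto split: if_splits)
      have cl: "cliq (cand x k)"
        by (rule cand_clique[OF k c(1,2)]) (use c(3) ok okk in blast)
      show ?case
      proof (rule runs_mono[OF runs_store_cand[OF inpr order_refl]], simp, goal_cases)
        case (1 r')
        have out: "answer r' = {e \<in> cand x k. 0 < w e}"
          using 1 \<open>(\<forall>e<n. nat_cell r ''m'' e 0 = _ e) \<and> _\<close> cand_subset[OF k, of x]
          by (auto simp: answer_def)
        have "cliq (answer r')" using cl unfolding out cliq_def by auto
        moreover have "(\<Sum>v\<in>answer r'. w v) = (\<Sum>e\<in>cand x k. max 0 (w e))"
          unfolding out using finite_subset[OF cand_subset[OF k]]
          by (intro sum.mono_neutral_cong_left) auto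
        ultimately show ?case
          using br 1 c(4) \<open>_ \<and> real_cell r ''sum'' 0 0 = _ \<and> _\<close>
          unfolding best_before_def by (fastforce simp: less_Suc_eq)
      qed
    next
      \<comment> \<open>A pair that is not stored fails \<open>all_ok\<close> or weighs no more than
        the current best.\<close>
      case 3
      have "(\<Sum>e\<in>cand x k. max 0 (w e)) \<le> real_cell r ''best'' 0 0" if "all_ok x k"
      proof -
        have "\<forall>e\<in>insert k (preds x k). nat_cell s' ''ok'' e 0 = 1"
          using that ok ok' okk by (auto simp: all_ok_def)
        then show ?thesis
          using 3 1(1) dr facts that by (auto simp: all_ok_def)
      qed
      then show ?case using br by (auto simp: best_before_def less_Suc_eq)
    qed simp
  qed simp
next
  \<comment> \<open>Having passed every \<open>d < n\<close> at \<open>x\<close> amounts to standing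
    at the start of \<open>Suc x\<close>.\<close>
  case (8 s')
  then show ?case by (auto simp: best_before_def less_Suc_eq)
qed (use inp B best in \<open>auto simp: holds_input_def weigh_cand_def store_cand_def algebra_simps
  cong: best_before_cong\<close>)

text \<open>Each of the four phases for one \<open>x\<close> fits into
  \<open>n * (n * 430 + 300) + 12\<close>, and \<open>x\<close> takes \<open>n + 1\<close> values;
  the constant 3000 leaves room for overhead.\<close>

lemma runs_mwc_program:
  assumes inp: "holds_input w 0 s" and n: "n > 0" and out: "nat_cell s ''out'' = (\<lambda>i j. 0)"
    and best: "real_cell s ''best'' 0 0 = 0" and B: "3000 * (n + 1) ^ 3 \<le> B"
  shows "runs mwc_program s B (best_before w (Suc n) 0)"
  unfolding mwc_program_def
proof (rule runs_Seq_NAssign, use B n in \<open>simp add: power3_eq_cube\<close>,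
    rule runs_For[where N = "n + 1" and I = "\<lambda>k. best_before w k 0"
      and b = "4 * (n * (n * 430 + 300) + 12)"], goal_cases)
  case (7 k s')
  note writes = count_common_def find_preds_def check_preds_def find_parent_def
    compare_preds_def improve_def weigh_cand_def store_cand_def
  let ?b = "n * (n * 430 + 300) + 12"
  have b: "n * (n * 215 + 100) + 12 \<le> ?b" by simp
  have s': "holds_input w k s'"
    using inp 7(3) agree_off_nat[OF 7(4)] agree_off_real[OF 7(4)]
    by (simp add: holds_input_def writes)
  show ?case
  proof (rule runs_Seq[where b = ?b and b' = "3 * ?b"], rule runs_frame,
      rule runs_count_common[OF s' b], goal_cases)
    case (1 s1)
    note s1 = 1
    have i1: "holds_input w k s1"
      by (rule holds_input_agree[OF s' s1(2)]) (auto simp: writes)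
    show ?case
    proof (rule runs_Seq[where b = ?b and b' = "2 * ?b"], rule runs_frame,
        rule runs_find_preds[OF i1 b s1(1)], goal_cases)
      case (1 s2)
      note s2 = 1
      have i2: "holds_input w k s2"
        by (rule holds_input_agree[OF i1 s2(2)]) (auto simp: writes)
      show ?case
      proof (rule runs_Seq[where b = ?b and b' = ?b], rule runs_frame,
          rule runs_check_preds[OF i2 order_refl s2(1)], goal_cases)
        case (1 s3)
        have i3: "holds_input w k s3"
          by (rule holds_input_agree[OF i2 1(2)]) (auto simp: writes)
        show ?case
        proof (rule runs_improve[OF i3 order_refl _ 1(1)])
          show "\<forall>d<n. \<forall>e<n. nat_cell s3 ''p'' d e = of_bool (e \<in> preds k d)"
            using s2(1) agree_off_nat[OF 1(2)] by (simp add: writes)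
          have "best_before w k 0 s3 \<longleftrightarrow> best_before w k 0 s'"
            by (rule best_before_cong)
              (simp_all add: writes agree_off_nat[OF 1(2)] agree_off_nat[OF s2(2)]
                agree_off_nat[OF s1(2)] agree_off_real[OF 1(2)] agree_off_real[OF s2(2)]
                agree_off_real[OF s1(2)])
          with 7(2) show "best_before w k 0 s3" by simp
        qed
      qed simp
    qed simp
  qed simp
next
  case 5
  show ?case using out best by (simp add: best_before_def answer_def cliq_def)
next
  case (6 k x s')
  then show ?case using best_before_cong[of "nat_write ''x'' 0 0 x s'" s'] by simp
next
  case 9
  show ?case
    by (rule order_trans[OF _ diff_le_mono[OF B]]) (use n in \<open>simp add: power3_eq_cube algebra_simps\<close>)
qed (use inp in \<open>auto simp: holds_input_def count_common_def find_preds_def check_preds_def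
  find_parent_def compare_preds_def improve_def weigh_cand_def store_cand_def\<close>)

text \<open>Extend \<open>L\<close> to a maximal clique \<open>K\<close>, which is a candidate.
  Passing to positive parts of the weights cannot decrease the sum and makes it monotone from
  \<open>L\<close> to \<open>K\<close>.\<close>

lemma best_answer:
  assumes best: "best_before w (Suc n) 0 s" and n: "n > 0"
  shows "cliq (answer s)" and "cliq L \<Longrightarrow> (\<Sum>v\<in>L. w v) \<le> (\<Sum>v\<in>answer s. w v)"
proof -
  show "cliq (answer s)" using best by (simp add: best_before_def)
  assume L: "cliq L"
  have "finite {K. cliq K}"
    by (rule finite_subset[of _ "Pow {..<n}"]) (auto simp: cliq_def)
  then obtain K where K: "cliq K" "L \<subseteq> K" and max: "\<And>M. cliq M \<Longrightarrow> K \<subseteq> M \<Longrightarrow> M = K"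
    using finite_has_maximal2[of "{K. cliq K}" L] L by auto
  have "K \<noteq> {}"
  proof
    assume "K = {}"
    moreover have "cliq {0}" using n by (simp add: cliq_def)
    ultimately show False using max[of "{0}"] by simp
  qed
  then obtain x d where xd: "x \<le> n" "d < n" "d \<noteq> x" "\<not> A x d"
    "\<forall>e\<in>insert d (preds x d). strong_ok x e" "cand x d = K"
    using maximal_clique_is_cand[OF K(1)] max by metis
  have finK: "finite K" using K(1) finite_subset by (auto simp: cliq_def)
  have "(\<Sum>v\<in>L. w v) \<le> (\<Sum>v\<in>L. max 0 (w v))" by (rule sum_mono) simp
  also have "\<dots> \<le> (\<Sum>v\<in>K. max 0 (w v))" using K finK by (intro sum_mono2) auto
  also have "\<dots> \<le> (\<Sum>v\<in>answer s. w v)"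
  proof -
    have "all_ok x d" using xd by (simp add: all_ok_def)
    then show ?thesis using best xd unfolding best_before_def by (metis less_Suc_eq_le)
  qed
  finally show "(\<Sum>v\<in>L. w v) \<le> (\<Sum>v\<in>answer s. w v)" .
qed

end

section \<open>Excluded cycles\<close>

text \<open>The map has to go from the subgraph to \<open>H\<close>, so it is the inverse of
  indexing into \<open>xs\<close>.\<close>

lemma isomorphic_nth:
  assumes "distinct xs" "length xs = k" "verts H = {..<k}"
    and "\<And>i j. i < k \<Longrightarrow> j < k \<Longrightarrow> adj G (xs ! i) (xs ! j) \<longleftrightarrow> adj H i j"
  shows "graph_isomorphic (induced_subgraph G (set xs)) H"
proof -
  have "bij_betw ((!) xs) {..<k} (set xs)"
    using assms(1,2) by (intro bij_betw_nth) auto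
  then have b: "bij_betw (the_inv_into {..<k} ((!) xs)) (set xs) {..<k}"
    by (rule bij_betw_the_inv_into)
  have inv: "the_inv_into {..<k} ((!) xs) (xs ! i) = i" if "i < k" for i
    using that assms(1,2) by (intro the_inv_into_f_f) (auto simp: inj_on_def nth_eq_iff_index_eq)
  show ?thesis
    unfolding graph_isomorphic_def
    by (rule exI[of _ "the_inv_into {..<k} ((!) xs)"])
      (use b assms inv in \<open>auto simp: induced_subgraph_def in_set_conv_nth\<close>)
qed

lemma C4_C5_free_graph:
  assumes G: "simple_graph G" "verts G = {..<n}"
    and free: "graph_free \<H> G" "cycle_graph 4 \<in> \<H>" "cycle_graph 5 \<in> \<H>"
  shows "C4_C5_free (adj G) n"
proof
  have sym: "adj G u v \<Longrightarrow> adj G v u" and irr: "\<not> adj G v v"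
    and V: "adj G u v \<Longrightarrow> u \<in> verts G" for u v
    using G by (auto simp: simple_graph_def)
  show "adj G a b \<Longrightarrow> adj G b a" for a b by (rule sym)
  show "\<not> adj G a a" for a by (rule irr)
  show "adj G a b \<Longrightarrow> a < n" for a b using V G by auto
  have no: "\<not> graph_isomorphic (induced_subgraph G (set xs)) (cycle_graph k)"
    if "set xs \<subseteq> verts G" "k = 4 \<or> k = 5" for xs k
    using free that unfolding graph_free_def by blast
  show "adj G a c \<or> adj G b d"
    if h: "adj G a b" "adj G b c" "adj G c d" "adj G d a" "a \<noteq> c" "b \<noteq> d" for a b c d
  proof (rule ccontr)
    assume neg: "\<not> ?thesis"
    have non: "\<not> adj G a c" "\<not> adj G c a" "\<not> adj G b d" "\<not> adj G d b"
      using neg sym by blast+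
    have dis: "distinct [a, b, c, d]" using h irr by auto
    have "graph_isomorphic (induced_subgraph G (set [a, b, c, d])) (cycle_graph 4)"
    proof (rule isomorphic_nth[OF dis])
      fix i j :: nat
      assume "i < 4" "j < 4"
      then have "i \<in> {0, 1, 2, 3}" "j \<in> {0, 1, 2, 3}" by auto
      then show "adj G ([a, b, c, d] ! i) ([a, b, c, d] ! j) \<longleftrightarrow> adj (cycle_graph 4) i j"
        by (elim insertE emptyE; simp add: cycle_graph_def h h(1-4)[THEN sym] non irr)
    qed (simp_all add: cycle_graph_def)
    then show False using no[of "[a, b, c, d]" 4] V[OF h(1)] V[OF h(2)] V[OF h(3)] V[OF h(4)] by simp
  qed
  show "adj G a c \<or> adj G b d \<or> adj G c e \<or> adj G d a \<or> adj G e b"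
    if h: "adj G a b" "adj G b c" "adj G c d" "adj G d e" "adj G e a"
      and dis: "distinct [a, b, c, d, e]" for a b c d e
  proof (rule ccontr)
    assume neg: "\<not> ?thesis"
    have non: "\<not> adj G a c" "\<not> adj G c a" "\<not> adj G b d" "\<not> adj G d b" "\<not> adj G c e" "\<not> adj G e c" "\<not> adj G d a" "\<not> adj G a d" "\<not> adj G e b" "\<not> adj G b e"
      using neg sym by blast+
    have "graph_isomorphic (induced_subgraph G (set [a, b, c, d, e])) (cycle_graph 5)"
    proof (rule isomorphic_nth[OF dis])
      fix i j :: nat
      assume "i < 5" "j < 5"
      then have "i \<in> {0, 1, 2, 3, 4}" "j \<in> {0, 1, 2, 3, 4}" by auto
      then show "adj G ([a, b, c, d, e] ! i) ([a, b, c, d, e] ! j) \<longleftrightarrow> adj (cycle_graph 5) i j"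
        by (elim insertE emptyE; simp add: cycle_graph_def h h[THEN sym] non irr)
    qed (simp_all add: cycle_graph_def)
    then show False
      using no[of "[a, b, c, d, e]" 5] V[OF h(1)] V[OF h(2)] V[OF h(3)] V[OF h(4)] V[OF h(5)] by simp
  qed
qed

section \<open>The cubic bound\<close>

lemma bigo_cube: "(\<lambda>n. real (c * (n + 1) ^ 3)) \<in> O(\<lambda>n. real n ^ 3)"
\<comment> \<open>The factor 8 comes from \<open>n + 1 \<le> 2 * n\<close> for positive
  \<open>n\<close>.\<close>
proof (rule bigoI[where c = "8 * real c"])
  have "real (c * (n + 1) ^ 3) \<le> 8 * real c * real n ^ 3" if "n \<ge> 1" for n
  proof -
    have "real (n + 1) ^ 3 \<le> (2 * real n) ^ 3" using that by (intro power_mono) auto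
    then have "real c * real (n + 1) ^ 3 \<le> real c * (2 * real n) ^ 3"
      by (intro mult_left_mono) auto
    then show ?thesis by (simp add: power_mult_distrib mult_ac)
  qed
  then show "\<forall>\<^sub>F n in at_top. norm (real (c * (n + 1) ^ 3)) \<le> 8 * real c * norm (real n ^ 3)"
    by (intro eventually_at_top_linorderI[of 1]) simp
qed

theorem mainTheorem5:
  "\<exists>P T. (\<lambda>n. real (T n)) \<in> O(\<lambda>n. real n ^ 3) \<and>
     solves_mwc_in_time P
       {G :: nat graph. graph_free {path_graph 7, cycle_graph 4, cycle_graph 5} G} T"
proof (intro exI conjI)
  show "(\<lambda>n. real (3000 * (n + 1) ^ 3)) \<in> O(\<lambda>n. real n ^ 3)" by (rule bigo_cube)
  show "solves_mwc_in_time mwc_program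
     {G :: nat graph. graph_free {path_graph 7, cycle_graph 4, cycle_graph 5} G}
     (\<lambda>n. 3000 * (n + 1) ^ 3)"
    unfolding solves_mwc_in_time_def
  proof (intro ballI allI impI, elim conjE)
    fix G :: "nat graph" and w :: "nat \<Rightarrow> real"
    assume free: "G \<in> {G. graph_free {path_graph 7, cycle_graph 4, cycle_graph 5} G}"
      and G: "simple_graph G"
    define n where "n = card (verts G)"
    assume "verts G = {..<card (verts G)}"
    then have V: "verts G = {..<n}" by (simp add: n_def)
    have n: "n > 0" using G V by (auto simp: simple_graph_def)
    interpret C4_C5_free "adj G" n
      by (rule C4_C5_free_graph[OF G V]) (use free in auto)
    \<comment> \<open>All other cells start at zero, so the initial answer is the empty clique with
      its weight 0 in \<open>best\<close>.\<close>
    have "runs mwc_program (mwc_input G w) (3000 * (n + 1) ^ 3) (best_before w (Suc n) 0)"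
      by (rule runs_mwc_program)
        (use n V in \<open>auto simp: holds_input_def mwc_input_def fun_eq_iff\<close>)
    then obtain t s where t: "exec mwc_program (mwc_input G w) t s" "t \<le> 3000 * (n + 1) ^ 3"
      and best: "best_before w (Suc n) 0 s" unfolding runs_def by blast
    have "cliq = clique G" by (auto simp: fun_eq_iff cliq_def clique_def V)
    moreover have "mwc_output G s = answer s"
      by (simp add: mwc_output_def answer_def V)
    ultimately have "max_weight_clique G w (mwc_output G s)"
      using best_answer[OF best n]
      by (auto simp: max_weight_clique_def is_arg_max_def not_less)
    then show "\<exists>t s. exec mwc_program (mwc_input G w) t s \<and>
        t \<le> 3000 * (card (verts G) + 1) ^ 3 \<and> max_weight_clique G w (mwc_output G s)"
      using t unfolding n_def by blast
  qed
qed

end
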